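(* Let $(\overline y,\overline p,\overline u)$ be a solution to the continuous KKT system (K). If $\overline c\in\mathbb R$ is such that $\frac1{|\Omega|}\int_\Omega P_{[a,b]}\big(-\frac1\alpha\overline p(x)+\overline c\big)\,dx=0$, then the continuous optimal control satisfies $$\overline u(x)=P_{[a,b]}\Big(-\frac1\alpha\overline p(x)+\overline c\Big)\quad\text{for a.e. }x\in\Omega.$$ If $\mathcal D$ is a gradient discretisation, $(\overline y_{\mathcal D},\overline p_{\mathcal D},\overline u_h)$ is a solution to the discrete KKT system (DK), and $\overline p_{\mathcal D}$ is chosen such that $$\frac1{|\Omega|}\int_\Omega P_{[a,b]}\Big(\mathcal P_{\mathcal T}\Big(-\frac1\alpha\Pi_{\mathcal D}\overline p_{\mathcal D}\Big)\Big)\,dx=0,$$ then the discrete optimal control is given by $$\overline u_h(x)=P_{[a,b]}\Big(\mathcal P_{\mathcal T}\Big(-\frac1\alpha\Pi_{\mathcal D}\overline p_{\mathcal D}\Big)(x)\Big)\quad\text{for a.e. }x\in\Omega.$$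
   Context: Setting. $\Omega\subset\mathbb R^d$ ($d\le 3$) is a bounded domain with boundary $\partial\Omega$; $\|\cdot\|$ and $(\cdot,\cdot)$ are the norm and inner product of $L^2(\Omega)$ (or $L^2(\Omega)^d$); $|E|$ is Lebesgue measure. $A:\Omega\to\mathcal M_d(\mathbb R)$ is measurable, bounded, uniformly elliptic, with $A(x)$ symmetric for a.e. $x$. $\alpha>0$; $f,\overline y_d\in L^2(\Omega)$ both have zero average over $\Omega$; $a,b\in[-\infty,+\infty]$ are constants with $a<0<b$; $P_{[a,b]}(s)=\min(b,\max(a,s))$ for $s\in\mathbb R$. $$\mathcal U_{\rm ad}=\Big\{u\in L^2(\Omega): a\le u\le b,\ \tfrac1{|\Omega|}\int_\Omega u\,dx=0\Big\},\qquad H^1_\star(\Omega)=\Big\{w\in H^1(\Omega):\int_\Omega w\,dx=0\Big\},$$ $a(\phi,\psi)=\int_\Omega A\nabla\phi\cdot\nabla\psi\,dx$ for $\phi,\psi\in H^1(\Omega)$. Continuous KKT system (K) (optimality conditions for minimising $\frac12\|y-\overline y_d\|^2+\frac\alpha2\|u\|^2$ over $u\in\mathcal U_{\rm ad}$ subject to $-\mathrm{div}(A\nabla y)=u+f$ in $\Omega$, $A\nabla y\cdot\mathbf n=0$ on $\partial\Omega$, $\int_\Omega y=0$): $(\overline y,\overline p,\overline u)\in H^1_\star(\Omega)\times H^1(\Omega)\times\mathcal U_{\rm ad}$; $a(\overline y,w)=(\overline u+f,w)$ for all $w\in H^1_\star(\Omega)$; $a(z,\overline p)=(\overline y-\overline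 y_d,z)$ for all $z\in H^1(\Omega)$; $(\overline p+\alpha\overline u,v-\overline u)\ge0$ for all $v\in\mathcal U_{\rm ad}$. Any such $\overline p$ is called a co-state (it is determined only up to an additive constant). Gradient discretisation (GD): a triple $\mathcal D=(X_{\mathcal D},\Pi_{\mathcal D},\nabla_{\mathcal D})$ where $X_{\mathcal D}$ is a finite-dimensional real vector space, $\Pi_{\mathcal D}:X_{\mathcal D}\to L^2(\Omega)$ and $\nabla_{\mathcal D}:X_{\mathcal D}\to L^2(\Omega)^d$ are linear, $\|w\|_{\mathcal D}^2:=\|\nabla_{\mathcal D}w\|^2+\big|\frac1{|\Omega|}\int_\Omega\Pi_{\mathcal D}w\,dx\big|^2$ defines a norm on $X_{\mathcal D}$, and there exists $1_{\mathcal D}\in X_{\mathcal D}$ with $\Pi_{\mathcal D}1_{\mathcal D}=1$ and $\nabla_{\mathcal D}1_{\mathcal D}=0$ on $\Omega$. Set $X_{\mathcal D,\star}=\{w\in X_{\mathcal D}:\int_\Omega\Pi_{\mathcal D}w\,dx=0\}$ and $a_{\mathcal D}(\phi,z)=\int_\Omega A\nabla_{\mathcal D}\phi\cdot\nabla_{\mathcal D}z\,dx$ for $\phi,z\in X_{\mathcal D}$. $\mathcal T$ is a mesh of $\Omega$ (partition into polygonal/polyhedral cells $K$), $\mathcal U_h$ is the space of functions constant on each cell of $\mathcal T$, $\mathcal U_{{\rm ad},h}=\mathcal U_{\rm ad}\cap\mathcal U_h$, and $\mathcal P_{\mathcal T}:L^1(\Omega)\to\mathcal U_h$ is the cellwise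 average, $(\mathcal P_{\mathcal T}v)_{|K}=\frac1{|K|}\int_Kv\,dx$. Discrete KKT system (DK): $(\overline y_{\mathcal D},\overline p_{\mathcal D},\overline u_h)\in X_{\mathcal D,\star}\times X_{\mathcal D}\times\mathcal U_{{\rm ad},h}$; $a_{\mathcal D}(\overline y_{\mathcal D},w)=(\overline u_h+f,\Pi_{\mathcal D}w)$ for all $w\in X_{\mathcal D,\star}$; $a_{\mathcal D}(z,\overline p_{\mathcal D})=(\Pi_{\mathcal D}\overline y_{\mathcal D}-\overline y_d,\Pi_{\mathcal D}z)$ for all $z\in X_{\mathcal D}$; $(\Pi_{\mathcal D}\overline p_{\mathcal D}+\alpha\overline u_h,v_h-\overline u_h)\ge0$ for all $v_h\in\mathcal U_{{\rm ad},h}$. *)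

theory Defs
  imports "HOL-Analysis.Analysis"
begin

text \<open>
  Elements of Lebesgue and Sobolev spaces are represented by functions. Properties of an
  element of such a space, among them linearity of operators with values in it, are required
  almost everywhere.
\<close>

definition L2 :: "(real^'d) set \<Rightarrow> (real^'d \<Rightarrow> 'b::euclidean_space) set" where
  "L2 S = {f. f \<in> borel_measurable (lebesgue_on S) \<and> integrable (lebesgue_on S) (\<lambda>x. (norm (f x))\<^sup>2)}"

definition L2_inner ::
  "(real^'d) set \<Rightarrow> (real^'d \<Rightarrow> 'b::euclidean_space) \<Rightarrow> (real^'d \<Rightarrow> 'b) \<Rightarrow> real" where
  "L2_inner S f g = (LINT x|lebesgue_on S. f x \<bullet> g x)"

definition L2_norm :: "(real^'d) set \<Rightarrow> (real^'d \<Rightarrow> 'b::euclidean_space) \<Rightarrow> real" where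
  "L2_norm S f = sqrt (L2_inner S f f)"

definition average :: "(real^'d) set \<Rightarrow> (real^'d \<Rightarrow> real) \<Rightarrow> real" where
  "average S f = 1 / measure lebesgue S * (LINT x|lebesgue_on S. f x)"


subsection \<open>Sobolev space\<close>

definition partial :: "'d \<Rightarrow> (real^'d \<Rightarrow> real) \<Rightarrow> real^'d \<Rightarrow> real" where
  "partial i \<phi> x = frechet_derivative \<phi> (at x) (axis i 1)"

primrec Ck :: "nat \<Rightarrow> (real^'d \<Rightarrow> real) \<Rightarrow> bool" where
  "Ck 0 \<phi> \<longleftrightarrow> continuous_on UNIV \<phi>"
| "Ck (Suc k) \<phi> \<longleftrightarrow> (\<forall>x. \<phi> differentiable (at x)) \<and> (\<forall>i. Ck k (partial i \<phi>))"

definition test_functions :: "(real^'d) set \<Rightarrow> (real^'d \<Rightarrow> real) set" where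
  "test_functions \<Omega> =
     {\<phi>. (\<forall>k. Ck k \<phi>) \<and> (\<exists>K. compact K \<and> K \<subseteq> \<Omega> \<and> (\<forall>x. x \<notin> K \<longrightarrow> \<phi> x = 0))}"

definition is_weak_gradient ::
  "(real^'d) set \<Rightarrow> (real^'d \<Rightarrow> real) \<Rightarrow> (real^'d \<Rightarrow> real^'d) \<Rightarrow> bool" where
  "is_weak_gradient \<Omega> w g \<longleftrightarrow> g \<in> L2 \<Omega> \<and>
     (\<forall>\<phi>\<in>test_functions \<Omega>. \<forall>i.
        (LINT x|lebesgue_on \<Omega>. w x * partial i \<phi> x) = - (LINT x|lebesgue_on \<Omega>. g x $ i * \<phi> x))"

definition H1 :: "(real^'d) set \<Rightarrow> (real^'d \<Rightarrow> real) set" where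
  "H1 \<Omega> = {w \<in> L2 \<Omega>. \<exists>g. is_weak_gradient \<Omega> w g}"

definition H1_star :: "(real^'d) set \<Rightarrow> (real^'d \<Rightarrow> real) set" where
  "H1_star \<Omega> = {w \<in> H1 \<Omega>. (LINT x|lebesgue_on \<Omega>. w x) = 0}"

text \<open>
  The weak gradient is unique up to null sets; which representative is chosen does not affect
  any integral below.
\<close>
definition weak_grad :: "(real^'d) set \<Rightarrow> (real^'d \<Rightarrow> real) \<Rightarrow> real^'d \<Rightarrow> real^'d" where
  "weak_grad \<Omega> w = (SOME g. is_weak_gradient \<Omega> w g)"


subsection \<open>Diffusion tensor and bilinear form\<close>

definition diffusion_tensor :: "(real^'d) set \<Rightarrow> (real^'d \<Rightarrow> real^'d^'d) \<Rightarrow> bool" where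
  "diffusion_tensor \<Omega> A \<longleftrightarrow>
     A \<in> borel_measurable (lebesgue_on \<Omega>) \<and>
     (\<exists>M. AE x in lebesgue_on \<Omega>. norm (A x) \<le> M) \<and>
     (\<exists>\<kappa>>0. AE x in lebesgue_on \<Omega>. \<forall>\<xi>. \<kappa> * (norm \<xi>)\<^sup>2 \<le> (A x *v \<xi>) \<bullet> \<xi>) \<and>
     (AE x in lebesgue_on \<Omega>. transpose (A x) = A x)"

text \<open>
  This takes the (weak or reconstructed) gradients as arguments, so that it yields both the
  continuous and the discrete bilinear form.
\<close>
definition diffusion_form ::
  "(real^'d) set \<Rightarrow> (real^'d \<Rightarrow> real^'d^'d) \<Rightarrow> (real^'d \<Rightarrow> real^'d) \<Rightarrow> (real^'d \<Rightarrow> real^'d) \<Rightarrow> real" where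
  "diffusion_form \<Omega> A g h = L2_inner \<Omega> (\<lambda>x. A x *v g x) h"


subsection \<open>Continuous problem\<close>

text \<open>For \<open>a < 0 < b\<close> the clipped value is finite, so the conversion to a real loses nothing.\<close>
definition proj :: "ereal \<Rightarrow> ereal \<Rightarrow> real \<Rightarrow> real" where
  "proj a b s = real_of_ereal (min b (max a (ereal s)))"

definition U_ad :: "(real^'d) set \<Rightarrow> ereal \<Rightarrow> ereal \<Rightarrow> (real^'d \<Rightarrow> real) set" where
  "U_ad \<Omega> a b =
     {u \<in> L2 \<Omega>. (AE x in lebesgue_on \<Omega>. a \<le> ereal (u x) \<and> ereal (u x) \<le> b) \<and> average \<Omega> u = 0}"

definition KKT ::
  "(real^'d) set \<Rightarrow> (real^'d \<Rightarrow> real^'d^'d) \<Rightarrow> real \<Rightarrow> ereal \<Rightarrow> ereal \<Rightarrow>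
   (real^'d \<Rightarrow> real) \<Rightarrow> (real^'d \<Rightarrow> real) \<Rightarrow>
   (real^'d \<Rightarrow> real) \<Rightarrow> (real^'d \<Rightarrow> real) \<Rightarrow> (real^'d \<Rightarrow> real) \<Rightarrow> bool" where
  "KKT \<Omega> A \<alpha> a b f y\<^sub>d y p u \<longleftrightarrow>
     y \<in> H1_star \<Omega> \<and> p \<in> H1 \<Omega> \<and> u \<in> U_ad \<Omega> a b \<and>
     (\<forall>w\<in>H1_star \<Omega>. diffusion_form \<Omega> A (weak_grad \<Omega> y) (weak_grad \<Omega> w)
                        = L2_inner \<Omega> (\<lambda>x. u x + f x) w) \<and>
     (\<forall>z\<in>H1 \<Omega>. diffusion_form \<Omega> A (weak_grad \<Omega> z) (weak_grad \<Omega> p)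
                   = L2_inner \<Omega> (\<lambda>x. y x - y\<^sub>d x) z) \<and>
     (\<forall>v\<in>U_ad \<Omega> a b. L2_inner \<Omega> (\<lambda>x. p x + \<alpha> * u x) (\<lambda>x. v x - u x) \<ge> 0)"


subsection \<open>Mesh\<close>

text \<open>
  Cells are open and need not be convex: a cell is the interior of a finite union of (convex)
  polytopes. They cover the domain up to the cell boundaries, a null set.
\<close>
definition polytopal_cell :: "(real^'d) set \<Rightarrow> bool" where
  "polytopal_cell K \<longleftrightarrow> K \<noteq> {} \<and> connected K \<and>
     (\<exists>P. finite P \<and> (\<forall>p\<in>P. polytope p) \<and> K = interior (\<Union>P))"

definition polytopal_mesh :: "(real^'d) set \<Rightarrow> (real^'d) set set \<Rightarrow> bool" where
  "polytopal_mesh \<Omega> T \<longleftrightarrow> finite T \<and> (\<forall>K\<in>T. polytopal_cell K \<and> K \<subseteq> \<Omega>) \<and>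
     pairwise disjnt T \<and> (\<Union>K\<in>T. closure K) = closure \<Omega>"

definition U_h :: "(real^'d) set set \<Rightarrow> (real^'d \<Rightarrow> real) set" where
  "U_h T = {v. \<forall>K\<in>T. \<exists>c. AE x in lebesgue_on K. v x = c}"

definition U_ad_h ::
  "(real^'d) set \<Rightarrow> (real^'d) set set \<Rightarrow> ereal \<Rightarrow> ereal \<Rightarrow> (real^'d \<Rightarrow> real) set" where
  "U_ad_h \<Omega> T a b = U_ad \<Omega> a b \<inter> U_h T"

definition cell_average :: "(real^'d) set set \<Rightarrow> (real^'d \<Rightarrow> real) \<Rightarrow> real^'d \<Rightarrow> real" where
  "cell_average T v x = (\<Sum>K\<in>T. indicator K x * average K v)"


subsection \<open>Gradient discretisation and discrete problem\<close>

definition is_norm :: "('x::real_vector \<Rightarrow> real) \<Rightarrow> bool" where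
  "is_norm N \<longleftrightarrow> (\<forall>v. 0 \<le> N v) \<and> (\<forall>v. N v = 0 \<longleftrightarrow> v = 0) \<and>
     (\<forall>r v. N (r *\<^sub>R v) = \<bar>r\<bar> * N v) \<and> (\<forall>v w. N (v + w) \<le> N v + N w)"

definition L2_linear ::
  "(real^'d) set \<Rightarrow> ('x::real_vector \<Rightarrow> real^'d \<Rightarrow> 'b::euclidean_space) \<Rightarrow> bool" where
  "L2_linear \<Omega> L \<longleftrightarrow> (\<forall>v. L v \<in> L2 \<Omega>) \<and>
     (\<forall>v w. AE x in lebesgue_on \<Omega>. L (v + w) x = L v x + L w x) \<and>
     (\<forall>r v. AE x in lebesgue_on \<Omega>. L (r *\<^sub>R v) x = r *\<^sub>R L v x)"

definition GD_norm ::
  "(real^'d) set \<Rightarrow> ('x \<Rightarrow> real^'d \<Rightarrow> real) \<Rightarrow> ('x \<Rightarrow> real^'d \<Rightarrow> real^'d) \<Rightarrow> 'x \<Rightarrow> real" where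
  "GD_norm \<Omega> PiD gradD w = sqrt ((L2_norm \<Omega> (gradD w))\<^sup>2 + \<bar>average \<Omega> (PiD w)\<bar>\<^sup>2)"

text \<open>The space of discrete unknowns is the whole type \<open>'x\<close>, required to be finite-dimensional.\<close>
definition gradient_discretisation ::
  "(real^'d) set \<Rightarrow> ('x::real_vector \<Rightarrow> real^'d \<Rightarrow> real) \<Rightarrow> ('x \<Rightarrow> real^'d \<Rightarrow> real^'d) \<Rightarrow> bool" where
  "gradient_discretisation \<Omega> PiD gradD \<longleftrightarrow>
     (\<exists>B::'x set. finite B \<and> span B = UNIV) \<and>
     L2_linear \<Omega> PiD \<and> L2_linear \<Omega> gradD \<and>
     is_norm (GD_norm \<Omega> PiD gradD) \<and>
     (\<exists>one. (AE x in lebesgue_on \<Omega>. PiD one x = 1) \<and> (AE x in lebesgue_on \<Omega>. gradD one x = 0))"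

definition X_star :: "(real^'d) set \<Rightarrow> ('x \<Rightarrow> real^'d \<Rightarrow> real) \<Rightarrow> 'x set" where
  "X_star \<Omega> PiD = {w. (LINT x|lebesgue_on \<Omega>. PiD w x) = 0}"

definition discrete_KKT ::
  "(real^'d) set \<Rightarrow> (real^'d \<Rightarrow> real^'d^'d) \<Rightarrow> real \<Rightarrow> ereal \<Rightarrow> ereal \<Rightarrow>
   (real^'d \<Rightarrow> real) \<Rightarrow> (real^'d \<Rightarrow> real) \<Rightarrow>
   ('x::real_vector \<Rightarrow> real^'d \<Rightarrow> real) \<Rightarrow> ('x \<Rightarrow> real^'d \<Rightarrow> real^'d) \<Rightarrow> (real^'d) set set \<Rightarrow>
   'x \<Rightarrow> 'x \<Rightarrow> (real^'d \<Rightarrow> real) \<Rightarrow> bool" where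
  "discrete_KKT \<Omega> A \<alpha> a b f y\<^sub>d PiD gradD T y p u \<longleftrightarrow>
     y \<in> X_star \<Omega> PiD \<and> u \<in> U_ad_h \<Omega> T a b \<and>
     (\<forall>w\<in>X_star \<Omega> PiD. diffusion_form \<Omega> A (gradD y) (gradD w)
                           = L2_inner \<Omega> (\<lambda>x. u x + f x) (PiD w)) \<and>
     (\<forall>z. diffusion_form \<Omega> A (gradD z) (gradD p)
            = L2_inner \<Omega> (\<lambda>x. PiD y x - y\<^sub>d x) (PiD z)) \<and>
     (\<forall>v\<in>U_ad_h \<Omega> T a b. L2_inner \<Omega> (\<lambda>x. PiD p x + \<alpha> * u x) (\<lambda>x. v x - u x) \<ge> 0)"

end

theory Submission
  imports Defs
begin

text \<open>
  Put \<open>g = - p / \<alpha> + c\<close>. The optimality condition of the continuous problem says that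
  \<open>u\<close> is the \<open>L\<^sup>2\<close> projection of \<open>- p / \<alpha>\<close> onto the admissible set. On directions of zero
  mean the constant \<open>c\<close> is invisible, so that \<open>u\<close> also satisfies the variational inequality
  of the projection of \<open>g\<close>. The truncation \<open>P = proj a b \<circ> g\<close> satisfies that inequality
  pointwise against every function with values in the interval, and it is itself admissible exactly
  because \<open>c\<close> makes its mean vanish. Testing each inequality with the other function and adding
  them leaves \<open>\<parallel>P - u\<parallel>\<^sup>2 \<le> 0\<close>: this is \<open>AE_eq_proj_if_variational\<close>.

  In the discrete problem \<open>g\<close> is the cellwise average of \<open>- p / \<alpha>\<close>, and the tested direction
  \<open>P - u\<close> is constant on every cell. Replacing a function by its cellwise average does not change
  its inner product with such a direction (\<open>integral_cell_average_mult\<close>), which plays the part of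
  the invisibility of the constant. Both problems thus reduce to \<open>AE_eq_proj_if_optimal\<close>, whose
  orthogonality hypothesis covers the two replacements of \<open>- p / \<alpha>\<close> by \<open>g\<close>.
\<close>

section \<open>Truncation to an interval\<close>

lemma ereal_proj:
  assumes "a < 0" "0 < b"
  shows "ereal (proj a b s) = min b (max a (ereal s))"
  using assms unfolding proj_def
  by (cases a; cases b) (auto simp: min_def max_def)

lemma proj_in_interval:
  assumes "a < 0" "0 < b"
  shows "a \<le> ereal (proj a b s)" "ereal (proj a b s) \<le> b"
  using assms by (auto simp: ereal_proj)

text \<open>Since \<open>0\<close> lies in the interval, truncation moves points towards it. This keeps truncations
  square-integrable even when the interval is unbounded.\<close>
lemma abs_proj_le:
  assumes "a < 0" "0 < b"
  shows "\<bar>proj a b s\<bar> \<le> \<bar>s\<bar>"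
  using assms unfolding proj_def
  by (cases a; cases b) (auto simp: min_def max_def)

text \<open>The sign condition that characterises the nearest point of an interval: either \<open>s\<close> is
  left unchanged, or it is moved to the end point on its side, and then the first factor points
  into the interval.\<close>
lemma proj_variational:
  assumes "a < 0" "0 < b" "a \<le> ereal w" "ereal w \<le> b"
  shows "0 \<le> (proj a b s - s) * (w - proj a b s)"
  using assms unfolding proj_def
  by (cases a; cases b) (auto simp: min_def max_def mult_nonpos_nonpos zero_le_mult_iff)

lemma borel_measurable_proj [measurable]: "proj a b \<in> borel_measurable borel"
  unfolding proj_def by measurable

section \<open>Square-integrable functions\<close>

lemma L2_realD:
  fixes v :: "real^'d \<Rightarrow> real"
  assumes "v \<in> L2 S"
  shows "v \<in> borel_measurable (lebesgue_on S)" "integrable (lebesgue_on S) (\<lambda>x. (v x)\<^sup>2)"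
  using assms by (auto simp: L2_def)

lemma L2_dominated:
  fixes v w :: "real^'d \<Rightarrow> real"
  assumes "w \<in> L2 S" "v \<in> borel_measurable (lebesgue_on S)" "\<And>x. \<bar>v x\<bar> \<le> \<bar>w x\<bar>"
  shows "v \<in> L2 S"
proof -
  note [measurable] = assms(2)
  have "integrable (lebesgue_on S) (\<lambda>x. (v x)\<^sup>2)"
    by (rule Bochner_Integration.integrable_bound[OF L2_realD(2)[OF assms(1)]])
       (use assms(3) in \<open>auto simp: abs_le_square_iff\<close>)
  then show ?thesis using assms(2) by (simp add: L2_def)
qed

lemma L2_add:
  fixes v w :: "real^'d \<Rightarrow> real"
  assumes "v \<in> L2 S" "w \<in> L2 S"
  shows "(\<lambda>x. v x + w x) \<in> L2 S"
proof -
  note [measurable] = L2_realD(1)[OF assms(1)] L2_realD(1)[OF assms(2)]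
  have "(v x + w x)\<^sup>2 \<le> 2 * (v x)\<^sup>2 + 2 * (w x)\<^sup>2" for x
    using zero_le_power2[of "v x - w x"] by (simp add: power2_eq_square algebra_simps)
  then have "norm ((v x + w x)\<^sup>2) \<le> norm (2 * (v x)\<^sup>2 + 2 * (w x)\<^sup>2)" for x
    by (metis abs_ge_self abs_power2 order_trans real_norm_def)
  then have "integrable (lebesgue_on S) (\<lambda>x. (v x + w x)\<^sup>2)"
    by (rule Bochner_Integration.integrable_bound[where f = "\<lambda>x. 2 * (v x)\<^sup>2 + 2 * (w x)\<^sup>2", rotated 2, OF AE_I2])
       (use L2_realD(2)[OF assms(1)] L2_realD(2)[OF assms(2)] in auto)
  then show ?thesis by (simp add: L2_def)
qed

lemma L2_cmult:
  fixes v :: "real^'d \<Rightarrow> real"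
  assumes "v \<in> L2 S"
  shows "(\<lambda>x. r * v x) \<in> L2 S"
  using assms by (auto simp: L2_def power_mult_distrib)

lemma L2_diff:
  fixes v w :: "real^'d \<Rightarrow> real"
  assumes "v \<in> L2 S" "w \<in> L2 S"
  shows "(\<lambda>x. v x - w x) \<in> L2 S"
  using L2_add[OF assms(1) L2_cmult[OF assms(2), of "-1"]] by simp

lemma L2_const:
  fixes r :: real and S :: "(real^'d) set"
  assumes "S \<in> lmeasurable"
  shows "(\<lambda>x. r) \<in> L2 S"
proof -
  have "finite_measure (lebesgue_on S)"
    using assms by (rule finite_measure_lebesgue_on)
  then show ?thesis by (simp add: L2_def finite_measure.integrable_const)
qed

lemma L2_integrable_mult:
  fixes v w :: "real^'d \<Rightarrow> real"
  assumes "v \<in> L2 S" "w \<in> L2 S"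
  shows "integrable (lebesgue_on S) (\<lambda>x. v x * w x)"
proof -
  note [measurable] = L2_realD(1)[OF assms(1)] L2_realD(1)[OF assms(2)]
  have "\<bar>v x * w x\<bar> \<le> (v x)\<^sup>2 + (w x)\<^sup>2" for x
  proof -
    have "2 * (\<bar>v x\<bar> * \<bar>w x\<bar>) \<le> (v x)\<^sup>2 + (w x)\<^sup>2"
      using sum_squares_bound[of "\<bar>v x\<bar>" "\<bar>w x\<bar>"] by simp
    moreover have "0 \<le> \<bar>v x\<bar> * \<bar>w x\<bar>" by simp
    ultimately show ?thesis unfolding abs_mult by linarith
  qed
  then have "norm (v x * w x) \<le> norm ((v x)\<^sup>2 + (w x)\<^sup>2)" for x
    by (metis abs_ge_self order_trans real_norm_def)
  then show ?thesis
    by (rule Bochner_Integration.integrable_bound[where f = "\<lambda>x. (v x)\<^sup>2 + (w x)\<^sup>2", rotated 2, OF AE_I2])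
       (use L2_realD(2)[OF assms(1)] L2_realD(2)[OF assms(2)] in auto)
qed

lemma L2_integrable:
  fixes v :: "real^'d \<Rightarrow> real"
  assumes "v \<in> L2 S" "S \<in> lmeasurable"
  shows "integrable (lebesgue_on S) v"
  using L2_integrable_mult[OF assms(1) L2_const[OF assms(2), of 1]] by simp

lemma L2_proj:
  assumes "a < 0" "0 < b" "g \<in> L2 S"
  shows "(\<lambda>x. proj a b (g x)) \<in> L2 S"
proof (rule L2_dominated[OF assms(3)])
  note [measurable] = L2_realD(1)[OF assms(3)]
  show "(\<lambda>x. proj a b (g x)) \<in> borel_measurable (lebesgue_on S)" by measurable
qed (rule abs_proj_le[OF assms(1,2)])

lemma average_eq_0_iff:
  assumes "open S" "S \<noteq> {}" "bounded S"
  shows "average S v = 0 \<longleftrightarrow> (LINT x|lebesgue_on S. v x) = 0"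
proof -
  have "measure lebesgue S \<noteq> 0"
    using assms negligible_iff_measure[of S] open_not_negligible lmeasurable_open by blast
  then show ?thesis by (simp add: average_def)
qed

lemma proj_in_U_ad:
  assumes "a < 0" "0 < b" "g \<in> L2 \<Omega>" "average \<Omega> (\<lambda>x. proj a b (g x)) = 0"
  shows "(\<lambda>x. proj a b (g x)) \<in> U_ad \<Omega> a b"
  using assms L2_proj[OF assms(1-3)] proj_in_interval[OF assms(1,2)]
  by (simp add: U_ad_def)

section \<open>Controls given by a truncation\<close>

text \<open>Abbreviate \<open>P = proj a b \<circ> g\<close>. The pointwise sign condition tested with \<open>u\<close> gives
  \<open>0 \<le> (P - g, u - P)\<close>, and the hypothesis is \<open>0 \<le> (u - g, P - u)\<close>. In the sum \<open>g\<close> cancels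
  and \<open>0 \<le> - (P - u, P - u)\<close> remains.\<close>
lemma AE_eq_proj_if_variational:
  assumes "a < 0" "0 < b" "g \<in> L2 \<Omega>" "u \<in> U_ad \<Omega> a b"
    and var: "0 \<le> (LINT x|lebesgue_on \<Omega>. (u x - g x) * (proj a b (g x) - u x))"
  shows "AE x in lebesgue_on \<Omega>. u x = proj a b (g x)"
proof -
  define P where "P x = proj a b (g x)" for x
  have P: "P \<in> L2 \<Omega>"
    unfolding P_def by (rule L2_proj[OF assms(1-3)])
  have u: "u \<in> L2 \<Omega>" and bnd: "AE x in lebesgue_on \<Omega>. a \<le> ereal (u x) \<and> ereal (u x) \<le> b"
    using assms(4) by (auto simp: U_ad_def)
  note L2s = L2_diff[OF P u] L2_diff[OF u P] L2_diff[OF P assms(3)] L2_diff[OF u assms(3)]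
  have sq: "integrable (lebesgue_on \<Omega>) (\<lambda>x. (P x - u x)\<^sup>2)"
    using L2_realD(2)[OF L2s(1)] .
  have "0 \<le> (LINT x|lebesgue_on \<Omega>. (P x - g x) * (u x - P x))"
    using bnd by (intro integral_nonneg_AE) (auto simp: P_def proj_variational assms(1,2))
  then have "0 \<le> (LINT x|lebesgue_on \<Omega>. (P x - g x) * (u x - P x))
      + (LINT x|lebesgue_on \<Omega>. (u x - g x) * (P x - u x))"
    using var by (simp add: P_def)
  also have "\<dots> = (LINT x|lebesgue_on \<Omega>. (P x - g x) * (u x - P x) + (u x - g x) * (P x - u x))"
    by (rule Bochner_Integration.integral_add[symmetric]; rule L2_integrable_mult; rule L2s)
  also have "\<dots> = (LINT x|lebesgue_on \<Omega>. - (P x - u x)\<^sup>2)"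
    by (rule Bochner_Integration.integral_cong) (auto simp: power2_eq_square algebra_simps)
  also have "\<dots> = - (LINT x|lebesgue_on \<Omega>. (P x - u x)\<^sup>2)"
    by simp
  finally have "(LINT x|lebesgue_on \<Omega>. (P x - u x)\<^sup>2) \<le> 0" by simp
  moreover have "0 \<le> (LINT x|lebesgue_on \<Omega>. (P x - u x)\<^sup>2)" by simp
  ultimately have "(LINT x|lebesgue_on \<Omega>. (P x - u x)\<^sup>2) = 0" by linarith
  then have "AE x in lebesgue_on \<Omega>. (P x - u x)\<^sup>2 = 0"
    using integral_nonneg_eq_0_iff_AE[OF sq] by simp
  then show ?thesis by (rule eventually_mono) (simp add: P_def)
qed

text \<open>The optimality condition involves \<open>p + \<alpha> u\<close>, whereas the truncation is compared with
  \<open>u - g\<close>. The two differ by the factor \<open>\<alpha>\<close> and by a function that is orthogonal to the tested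
  direction: a constant for the continuous problem, the fluctuation of the co-state inside the
  cells for the discrete one.\<close>
lemma AE_eq_proj_if_optimal:
  assumes "a < 0" "0 < b" "0 < \<alpha>" "g \<in> L2 \<Omega>" "p \<in> L2 \<Omega>" "u \<in> U_ad \<Omega> a b"
    and opt: "0 \<le> L2_inner \<Omega> (\<lambda>x. p x + \<alpha> * u x) (\<lambda>x. proj a b (g x) - u x)"
    and orth: "(LINT x|lebesgue_on \<Omega>. (- (1 / \<alpha>) * p x - g x) * (proj a b (g x) - u x)) = 0"
  shows "AE x in lebesgue_on \<Omega>. u x = proj a b (g x)"
proof (rule AE_eq_proj_if_variational[OF assms(1,2,4,6)])
  define d where "d x = proj a b (g x) - u x" for x
  have u: "u \<in> L2 \<Omega>"
    using assms(6) by (simp add: U_ad_def)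
  have d: "d \<in> L2 \<Omega>"
    unfolding d_def by (rule L2_diff[OF L2_proj[OF assms(1,2,4)] u])
  have "0 \<le> (1 / \<alpha>) * (LINT x|lebesgue_on \<Omega>. (p x + \<alpha> * u x) * d x)
      + (LINT x|lebesgue_on \<Omega>. (- (1 / \<alpha>) * p x - g x) * d x)"
    using opt orth \<open>0 < \<alpha>\<close> by (simp add: L2_inner_def d_def)
  also have "\<dots> = (LINT x|lebesgue_on \<Omega>. (1 / \<alpha>) * ((p x + \<alpha> * u x) * d x)
      + (- (1 / \<alpha>) * p x - g x) * d x)"
    by (subst Bochner_Integration.integral_add)
       (intro integrable_mult_right L2_integrable_mult d L2_add L2_diff L2_cmult u assms
          integral_mult_right_zero[symmetric] arg_cong2[where f = "(+)"] refl)+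
  also have "\<dots> = (LINT x|lebesgue_on \<Omega>. (u x - g x) * d x)"
    using \<open>0 < \<alpha>\<close> by (intro Bochner_Integration.integral_cong) (auto simp: field_simps)
  finally show "0 \<le> (LINT x|lebesgue_on \<Omega>. (u x - g x) * (proj a b (g x) - u x))"
    by (simp add: d_def)
qed

section \<open>Cellwise averages\<close>

lemma open_in_sets_lebesgue: "open S \<Longrightarrow> S \<in> sets lebesgue"
  by (simp add: borel_open)

lemma polytopal_mesh_cell:
  assumes "polytopal_mesh \<Omega> T" "K \<in> T"
  shows "open K" "K \<noteq> {}" "K \<subseteq> \<Omega>" "K \<in> sets lebesgue"
proof -
  show "open K" "K \<noteq> {}" "K \<subseteq> \<Omega>"
    using assms by (auto simp: polytopal_mesh_def polytopal_cell_def)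
  then show "K \<in> sets lebesgue"
    by (simp add: open_in_sets_lebesgue)
qed

text \<open>A cell need not be convex, but its boundary lies in the boundaries of the finitely many convex
  polytopes that make it up, and these are null sets.\<close>
lemma polytopal_cell_negligible_frontier:
  assumes "polytopal_cell K"
  shows "negligible (closure K - K)"
proof -
  from assms obtain P where P: "finite P" "\<forall>p\<in>P. polytope p" "K = interior (\<Union>P)"
    by (auto simp: polytopal_cell_def)
  have "closed (\<Union>P)"
    using P by (intro closed_Union) (auto intro: polytope_imp_closed)
  then have "closure K - K \<subseteq> frontier (\<Union>P)"
    using P(3) by (auto simp: frontier_def closure_closed dest: closure_mono[OF interior_subset, THEN subsetD])
  also have "\<dots> \<subseteq> (\<Union>p\<in>P. frontier p)"
  proof -
    have "closed (\<Union>p\<in>P. frontier p)"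
      using P(1) by (intro closed_UN) auto
    then show ?thesis
      using frontier_Union_subset_closure[of P] by (simp add: closure_closed)
  qed
  finally have sub: "closure K - K \<subseteq> (\<Union>p\<in>P. frontier p)" .
  have "negligible (\<Union>p\<in>P. frontier p)"
    using P by (intro negligible_Union) (auto intro!: negligible_convex_frontier polytope_imp_convex)
  then show ?thesis using sub by (rule negligible_subset)
qed

lemma polytopal_mesh_negligible_uncovered:
  assumes "polytopal_mesh \<Omega> T"
  shows "negligible (\<Omega> - \<Union>T)"
proof -
  have "\<Omega> \<subseteq> (\<Union>K\<in>T. closure K)"
    using assms closure_subset[of \<Omega>] by (simp add: polytopal_mesh_def)
  then have "\<Omega> - \<Union>T \<subseteq> (\<Union>K\<in>T. closure K - K)"
    by blast
  moreover have "negligible (\<Union>K\<in>T. closure K - K)"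
    using assms polytopal_cell_negligible_frontier
    by (intro negligible_Union) (auto simp: polytopal_mesh_def)
  ultimately show ?thesis by (rule negligible_subset[rotated])
qed

lemma sum_indicator_cell:
  fixes h :: "(real^'d) set \<Rightarrow> real"
  assumes "polytopal_mesh \<Omega> T" "K \<in> T" "x \<in> K"
  shows "(\<Sum>L\<in>T. indicator L x * h L) = h K"
proof -
  have "indicator L x * h L = (if L = K then h K else 0)" if "L \<in> T" for L
  proof -
    have "x \<notin> L" if "L \<noteq> K"
      using assms that \<open>L \<in> T\<close> by (auto simp: polytopal_mesh_def pairwise_def disjnt_iff)
    then show ?thesis
      using assms(3) by (auto simp: indicator_def)
  qed
  then have "(\<Sum>L\<in>T. indicator L x * h L) = (\<Sum>L\<in>T. if L = K then h K else 0)"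
    by (rule sum.cong[OF refl])
  then show ?thesis
    using assms by (simp add: polytopal_mesh_def)
qed

lemma cell_average_cell:
  assumes "polytopal_mesh \<Omega> T" "K \<in> T" "x \<in> K"
  shows "cell_average T v x = average K v"
  unfolding cell_average_def by (rule sum_indicator_cell[OF assms])

text \<open>Makes the truncated cell averages an admissible test function of the discrete problem.\<close>
lemma cellwise_in_U_h:
  assumes "polytopal_mesh \<Omega> T"
  shows "(\<lambda>x. h (cell_average T v x)) \<in> U_h T"
  unfolding U_h_def
proof (intro CollectI ballI exI)
  fix K assume K: "K \<in> T"
  have "K \<in> sets lebesgue"
    by (rule polytopal_mesh_cell(4)[OF assms K])
  then show "AE x in lebesgue_on K. h (cell_average T v x) = h (average K v)"
    by (intro AE_I2) (auto simp: space_restrict_space cell_average_cell[OF assms K])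
qed

lemma U_h_diff:
  assumes "v \<in> U_h T" "w \<in> U_h T"
  shows "(\<lambda>x. v x - w x) \<in> U_h T"
  unfolding U_h_def
proof (intro CollectI ballI)
  fix K assume "K \<in> T"
  then obtain c d where "AE x in lebesgue_on K. v x = c" "AE x in lebesgue_on K. w x = d"
    using assms by (fastforce simp: U_h_def)
  then have "AE x in lebesgue_on K. v x - w x = c - d" by eventually_elim simp
  then show "\<exists>c. AE x in lebesgue_on K. v x - w x = c" ..
qed

lemma L2_cell_average:
  assumes "polytopal_mesh \<Omega> T" "\<Omega> \<in> lmeasurable"
  shows "cell_average T v \<in> L2 \<Omega>"
proof (rule L2_dominated[OF L2_const[OF assms(2)]])
  have [measurable]: "K \<in> sets lebesgue" if "K \<in> T" for K
    by (rule polytopal_mesh_cell(4)[OF assms(1) that])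
  have "cell_average T v \<in> borel_measurable lebesgue"
    unfolding cell_average_def[abs_def]
    by (intro borel_measurable_sum borel_measurable_times borel_measurable_indicator) auto
  then show "cell_average T v \<in> borel_measurable (lebesgue_on \<Omega>)"
    by (rule measurable_restrict_space1)
  show "\<bar>cell_average T v x\<bar> \<le> \<bar>\<Sum>K\<in>T. \<bar>average K v\<bar>\<bar>" for x
  proof -
    have "\<bar>cell_average T v x\<bar> \<le> (\<Sum>K\<in>T. \<bar>indicator K x * average K v\<bar>)"
      unfolding cell_average_def by (rule sum_abs)
    also have "\<dots> \<le> (\<Sum>K\<in>T. \<bar>average K v\<bar>)"
      by (rule sum_mono) (auto simp: indicator_def)
    finally show ?thesis by linarith
  qed
qed

lemma integrable_on_cell:
  fixes F :: "real^'d \<Rightarrow> real"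
  assumes "polytopal_mesh \<Omega> T" "open \<Omega>" "K \<in> T" "integrable (lebesgue_on \<Omega>) F"
  shows "integrable (lebesgue_on K) F"
proof -
  have "K \<in> sets lebesgue" "K \<subseteq> \<Omega>" "\<Omega> \<in> sets lebesgue"
    using assms polytopal_mesh_cell[OF assms(1,3)] by (auto simp: open_in_sets_lebesgue)
  then show ?thesis
    using assms(4) set_integrable_subset[of lebesgue \<Omega> F K]
    by (simp add: integrable_restrict_space set_integrable_def)
qed

lemma integral_eq_sum_cells:
  fixes F :: "real^'d \<Rightarrow> real"
  assumes mesh: "polytopal_mesh \<Omega> T" and "open \<Omega>" and F: "integrable (lebesgue_on \<Omega>) F"
  shows "(LINT x|lebesgue_on \<Omega>. F x) = (\<Sum>K\<in>T. LINT x|lebesgue_on K. F x)"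
proof -
  have K: "K \<in> sets lebesgue" "K \<subseteq> \<Omega>" if "K \<in> T" for K
    using polytopal_mesh_cell[OF mesh that] by auto
  have \<Omega>: "\<Omega> \<in> sets lebesgue"
    using \<open>open \<Omega>\<close> by (rule open_in_sets_lebesgue)
  have intF: "integrable lebesgue (\<lambda>x. indicator K x *\<^sub>R F x)" if "K \<in> T" for K
    using integrable_on_cell[OF mesh \<open>open \<Omega>\<close> that F] K[OF that]
    by (simp add: integrable_restrict_space)
  have "AE x in lebesgue. indicator \<Omega> x *\<^sub>R F x = (\<Sum>K\<in>T. indicator K x *\<^sub>R F x)"
  proof (rule AE_I')
    show "\<Omega> - \<Union>T \<in> null_sets lebesgue"
      using polytopal_mesh_negligible_uncovered[OF mesh] by (simp add: negligible_iff_null_sets)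
    show "{x \<in> space lebesgue. indicator \<Omega> x *\<^sub>R F x \<noteq> (\<Sum>K\<in>T. indicator K x *\<^sub>R F x)} \<subseteq> \<Omega> - \<Union>T"
    proof (intro subsetI, rule ccontr)
      fix x assume x: "x \<in> {x \<in> space lebesgue. indicator \<Omega> x *\<^sub>R F x \<noteq> (\<Sum>K\<in>T. indicator K x *\<^sub>R F x)}"
        and "x \<notin> \<Omega> - \<Union>T"
      then consider "x \<notin> \<Omega>" | K where "K \<in> T" "x \<in> K" by blast
      then show False
      proof cases
        case 1
        then have "indicator K x *\<^sub>R F x = 0" if "K \<in> T" for K
          using K(2)[OF that] by (auto simp: indicator_def)
        then have "(\<Sum>K\<in>T. indicator K x *\<^sub>R F x) = 0"
          by (rule sum.neutral[OF ballI])
        then show False using x 1 by simp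
      next
        case 2
        then have "x \<in> \<Omega>" using K(2) by blast
        then show False
          using x sum_indicator_cell[OF mesh 2, of "\<lambda>_. F x"] by simp
      qed
    qed
  qed
  then have "(LINT x|lebesgue. indicator \<Omega> x *\<^sub>R F x)
      = (LINT x|lebesgue. (\<Sum>K\<in>T. indicator K x *\<^sub>R F x))"
    using F \<Omega> intF by (intro integral_cong_AE) (auto simp: integrable_restrict_space)
  also have "\<dots> = (\<Sum>K\<in>T. LINT x|lebesgue. indicator K x *\<^sub>R F x)"
    using intF by (rule Bochner_Integration.integral_sum)
  finally show ?thesis
    using \<Omega> K by (simp add: integral_restrict_space)
qed

text \<open>Cellwise averaging is the orthogonal projection onto the piecewise constant functions: on a
  cell, \<open>w\<close> is a constant that leaves the integral, and \<open>v\<close> and its average have the same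
  integral.\<close>
lemma integral_cell_average_mult:
  assumes mesh: "polytopal_mesh \<Omega> T" and \<Omega>: "open \<Omega>" "bounded \<Omega>"
    and v: "v \<in> L2 \<Omega>" and w: "w \<in> L2 \<Omega>" "w \<in> U_h T"
  shows "(LINT x|lebesgue_on \<Omega>. cell_average T v x * w x) = (LINT x|lebesgue_on \<Omega>. v x * w x)"
proof -
  have \<Omega>m: "\<Omega> \<in> lmeasurable" using \<Omega> by (simp add: lmeasurable_open)
  note ca = L2_cell_average[OF mesh \<Omega>m, of v]
  have "(LINT x|lebesgue_on K. cell_average T v x * w x) = (LINT x|lebesgue_on K. v x * w x)"
    if K: "K \<in> T" for K
  proof -
    have cell: "open K" "K \<noteq> {}" "K \<subseteq> \<Omega>"
      using polytopal_mesh_cell[OF mesh K] by auto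
    then have "bounded K" using \<Omega>(2) bounded_subset by blast
    then have Km: "K \<in> lmeasurable" using cell by (simp add: lmeasurable_open)
    have pos: "measure lebesgue K \<noteq> 0"
      using Km cell negligible_iff_measure[of K] open_not_negligible by blast
    note onK = integrable_on_cell[OF mesh \<Omega>(1) K]
    from w(2) K obtain c where c: "AE x in lebesgue_on K. w x = c" by (auto simp: U_h_def)
    have [measurable]: "w \<in> borel_measurable (lebesgue_on K)" "v \<in> borel_measurable (lebesgue_on K)"
      "cell_average T v \<in> borel_measurable (lebesgue_on K)"
      using onK[OF L2_integrable[OF w(1) \<Omega>m]] onK[OF L2_integrable[OF v \<Omega>m]]
        onK[OF L2_integrable[OF ca \<Omega>m]] by auto
    have "(LINT x|lebesgue_on K. cell_average T v x * w x) = (LINT x|lebesgue_on K. average K v * c)"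
    proof (rule integral_cong_AE)
      have "AE x in lebesgue_on K. cell_average T v x = average K v"
        using Km by (intro AE_I2) (auto simp: space_restrict_space cell_average_cell[OF mesh K])
      with c show "AE x in lebesgue_on K. cell_average T v x * w x = average K v * c"
        by eventually_elim simp
    qed auto
    also have "\<dots> = measure lebesgue K * (average K v * c)"
      using Km by (simp add: measure_restrict_space space_restrict_space)
    also have "\<dots> = (LINT x|lebesgue_on K. v x * c)"
      using pos by (simp add: average_def)
    also have "\<dots> = (LINT x|lebesgue_on K. v x * w x)"
      using c by (intro integral_cong_AE) (auto elim: eventually_mono)
    finally show ?thesis .
  qed
  then show ?thesis
    by (simp add: integral_eq_sum_cells[OF mesh \<Omega>(1)] L2_integrable_mult[OF ca w(1)]
        L2_integrable_mult[OF v w(1)])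
qed

theorem lemma3p10:
  fixes \<Omega> :: "(real^'d) set"
    and A :: "real^'d \<Rightarrow> real^'d^'d"
    and f y\<^sub>d :: "real^'d \<Rightarrow> real"
    and \<alpha> :: real and a b :: ereal
    and PiD :: "'x::real_vector \<Rightarrow> real^'d \<Rightarrow> real"
    and gradD :: "'x \<Rightarrow> real^'d \<Rightarrow> real^'d"
    and T :: "(real^'d) set set"
  assumes "CARD('d) \<le> 3"
    and "open \<Omega>" "connected \<Omega>" "bounded \<Omega>" "\<Omega> \<noteq> {}"
    and "diffusion_tensor \<Omega> A"
    and "0 < \<alpha>"
    and "f \<in> L2 \<Omega>" "average \<Omega> f = 0"
    and "y\<^sub>d \<in> L2 \<Omega>" "average \<Omega> y\<^sub>d = 0"
    and "a < 0" "0 < b"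
  shows "(\<forall>y p u c.
            KKT \<Omega> A \<alpha> a b f y\<^sub>d y p u \<and>
            average \<Omega> (\<lambda>x. proj a b (- (1 / \<alpha>) * p x + c)) = 0 \<longrightarrow>
            (AE x in lebesgue_on \<Omega>. u x = proj a b (- (1 / \<alpha>) * p x + c))) \<and>
         (gradient_discretisation \<Omega> PiD gradD \<and> polytopal_mesh \<Omega> T \<longrightarrow>
          (\<forall>y\<^sub>D p\<^sub>D u\<^sub>h.
            discrete_KKT \<Omega> A \<alpha> a b f y\<^sub>d PiD gradD T y\<^sub>D p\<^sub>D u\<^sub>h \<and>
            average \<Omega> (\<lambda>x. proj a b (cell_average T (\<lambda>x. - (1 / \<alpha>) * PiD p\<^sub>D x) x)) = 0 \<longrightarrow>
            (AE x in lebesgue_on \<Omega>.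
               u\<^sub>h x = proj a b (cell_average T (\<lambda>x. - (1 / \<alpha>) * PiD p\<^sub>D x) x))))"
proof (intro conjI allI impI; (elim conjE)?)
  have \<Omega>: "\<Omega> \<in> lmeasurable"
    using assms by (simp add: lmeasurable_open)
  have zero_mean: "(LINT x|lebesgue_on \<Omega>. v x) = 0" if "v \<in> U_ad \<Omega> a b" for v
    using that assms by (simp add: U_ad_def average_eq_0_iff)
  {
    fix y p u c
    assume kkt: "KKT \<Omega> A \<alpha> a b f y\<^sub>d y p u"
      and avg: "average \<Omega> (\<lambda>x. proj a b (- (1 / \<alpha>) * p x + c)) = 0"
    define g where "g x = - (1 / \<alpha>) * p x + c" for x
    have p: "p \<in> L2 \<Omega>" and u: "u \<in> U_ad \<Omega> a b"
      using kkt by (auto simp: KKT_def H1_def)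
    have g: "g \<in> L2 \<Omega>"
      unfolding g_def by (intro L2_add L2_cmult L2_const p \<Omega>)
    have P: "(\<lambda>x. proj a b (g x)) \<in> U_ad \<Omega> a b"
      using avg by (intro proj_in_U_ad g assms) (simp add: g_def)
    have "AE x in lebesgue_on \<Omega>. u x = proj a b (g x)"
    proof (rule AE_eq_proj_if_optimal[OF \<open>a < 0\<close> \<open>0 < b\<close> \<open>0 < \<alpha>\<close> g p u])
      show "0 \<le> L2_inner \<Omega> (\<lambda>x. p x + \<alpha> * u x) (\<lambda>x. proj a b (g x) - u x)"
        using kkt P by (simp add: KKT_def)
      \<comment> \<open>Both controls have zero mean, so their difference does not see the constant \<open>c\<close>.\<close>
      have "integrable (lebesgue_on \<Omega>) (\<lambda>x. proj a b (g x))" "integrable (lebesgue_on \<Omega>) u"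
        using P u \<Omega> by (auto simp: U_ad_def intro: L2_integrable)
      then have "(LINT x|lebesgue_on \<Omega>. - c * (proj a b (g x) - u x)) = 0"
        using zero_mean[OF P] zero_mean[OF u] by simp
      then show "(LINT x|lebesgue_on \<Omega>. (- (1 / \<alpha>) * p x - g x) * (proj a b (g x) - u x)) = 0"
        by (simp add: g_def)
    qed
    then show "AE x in lebesgue_on \<Omega>. u x = proj a b (- (1 / \<alpha>) * p x + c)"
      by (simp add: g_def)
  next
    fix y\<^sub>D p\<^sub>D u\<^sub>h
    assume gd: "gradient_discretisation \<Omega> PiD gradD" and mesh: "polytopal_mesh \<Omega> T"
      and kkt: "discrete_KKT \<Omega> A \<alpha> a b f y\<^sub>d PiD gradD T y\<^sub>D p\<^sub>D u\<^sub>h"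
      and avg: "average \<Omega> (\<lambda>x. proj a b (cell_average T (\<lambda>x. - (1 / \<alpha>) * PiD p\<^sub>D x) x)) = 0"
    define q where "q x = - (1 / \<alpha>) * PiD p\<^sub>D x" for x
    define g where "g = cell_average T q"
    have p: "PiD p\<^sub>D \<in> L2 \<Omega>" and u: "u\<^sub>h \<in> U_ad \<Omega> a b" "u\<^sub>h \<in> L2 \<Omega>" "u\<^sub>h \<in> U_h T"
      using gd kkt
      by (auto simp: gradient_discretisation_def L2_linear_def discrete_KKT_def U_ad_h_def U_ad_def)
    have q: "q \<in> L2 \<Omega>"
      unfolding q_def by (rule L2_cmult[OF p])
    have g: "g \<in> L2 \<Omega>"
      unfolding g_def by (rule L2_cell_average[OF mesh \<Omega>])
    have P: "(\<lambda>x. proj a b (g x)) \<in> U_ad \<Omega> a b" "(\<lambda>x. proj a b (g x)) \<in> U_h T"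
      using avg proj_in_U_ad[OF \<open>a < 0\<close> \<open>0 < b\<close> g] cellwise_in_U_h[OF mesh]
      by (auto simp: g_def q_def[abs_def])
    have "AE x in lebesgue_on \<Omega>. u\<^sub>h x = proj a b (g x)"
    proof (rule AE_eq_proj_if_optimal[OF \<open>a < 0\<close> \<open>0 < b\<close> \<open>0 < \<alpha>\<close> g p u(1)])
      show "0 \<le> L2_inner \<Omega> (\<lambda>x. PiD p\<^sub>D x + \<alpha> * u\<^sub>h x) (\<lambda>x. proj a b (g x) - u\<^sub>h x)"
        using kkt P by (simp add: discrete_KKT_def U_ad_h_def)
      define d where "d x = proj a b (g x) - u\<^sub>h x" for x
      have d: "d \<in> L2 \<Omega>" "d \<in> U_h T"
        unfolding d_def using P u by (auto simp: U_ad_def intro: L2_diff U_h_diff)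
      have "(LINT x|lebesgue_on \<Omega>. (q x - g x) * d x)
          = (LINT x|lebesgue_on \<Omega>. q x * d x) - (LINT x|lebesgue_on \<Omega>. g x * d x)"
        unfolding left_diff_distrib
        by (intro Bochner_Integration.integral_diff L2_integrable_mult q g d)
      also have "\<dots> = 0"
        using integral_cell_average_mult[OF mesh \<open>open \<Omega>\<close> \<open>bounded \<Omega>\<close> q d] by (simp add: g_def)
      finally show "(LINT x|lebesgue_on \<Omega>.
          (- (1 / \<alpha>) * PiD p\<^sub>D x - g x) * (proj a b (g x) - u\<^sub>h x)) = 0"
        by (simp add: q_def d_def)
    qed
    then show "AE x in lebesgue_on \<Omega>.
        u\<^sub>h x = proj a b (cell_average T (\<lambda>x. - (1 / \<alpha>) * PiD p\<^sub>D x) x)"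
      by (simp add: g_def q_def[abs_def])
  }
qed

end
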